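(* Let $1\le r\le m\le n$ be integers and $k>0$. Let $Y\in\mathbb{R}^{m\times n}$ have rank $r$ and entries in $[-k,k]$, let $E\in\mathbb{R}^{m\times n}$ be an additive error with $\widehat{Y}=Y+E$, and let $\Omega\subseteq\{1,\dots,m\}\times\{1,\dots,n\}$ be a nonempty set of observed positions. Let $Y^*=U^*V^{*T}$, where $(U^*,V^* )$ is a global optimal solution of $$\min_{U\in\mathbb{R}^{m\times r},\,V\in\mathbb{R}^{n\times r}}\ \frac12\left\|P_\Omega(UV^T-\widehat{Y})\right\|_F^2\quad\text{subject to}\quad \left|[UV^T]_{i,j}\right|\le k\ \text{ for all } i,j,$$ and assume $Y^*$ has rank $r$. Let $\mathcal{N},\mathcal{M}$ be the column space and row space of $Y$, and $\mathcal{N}^*,\mathcal{M}^*$ the column space and row space of $Y^*$; let $\Theta$ and $\Phi$ be the canonical angle matrices $\angle(\mathcal{N}^*,\mathcal{N})$ and $\angle(\mathcal{M}^*,\mathcal{M})$ respectively. Let $\delta=\sigma_r^*$ be the $r$-th largest singular value of $Y^*$. Then there exists a matrix $\Delta\in\mathbb{R}^{m\times n}$ satisfying $$\|\Delta\|\le\sqrt{\frac{mn}{|\Omega|}}\,\|P_\Omega(E)\|_F+\|E\|_F+\sqrt{mn}\,|\tau(\Omega)|$$ such that $$\|\sin\Theta\|\le\frac{\sqrt2}{\delta}\,\|\mathbb{P}^{\mathcal{N}^\perp}\Delta\|,\qquad \|\sin\Phi\|\le\frac{\sqrt2}{\delta}\,\|\mathbb{P}^{\mathcal{M}^\perp}\Delta^T\|,$$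 where $\|\cdot\|$ is either the Frobenius norm or the spectral norm. Furthermore, $\delta$ satisfies $$\sigma_r-\|\Delta\|_2\le\delta\le\sigma_r+\|\Delta\|_2,$$ $$\sigma_r^{\tilde Y_{\mathcal{N}}}-\|\mathbb{P}^{\mathcal{N}^\perp}\Delta\|_2\le\delta\le\sigma_r^{\tilde Y_{\mathcal{N}}}+\|\mathbb{P}^{\mathcal{N}^\perp}\Delta\|_2,$$ $$\sigma_r^{\tilde Y_{\mathcal{M}}}-\|\mathbb{P}^{\mathcal{M}^\perp}\Delta^T\|_2\le\delta\le\sigma_r^{\tilde Y_{\mathcal{M}}}+\|\mathbb{P}^{\mathcal{M}^\perp}\Delta^T\|_2,$$ where $\sigma_r$ is the $r$-th largest singular value of $Y$, $\tilde Y_{\mathcal{N}}=Y+\mathbb{P}^{\mathcal{N}}\Delta$, $\tilde Y_{\mathcal{M}}=Y+(\mathbb{P}^{\mathcal{M}}\Delta^T)^T$, and $\sigma_r^{\tilde Y_{\mathcal{N}}},\sigma_r^{\tilde Y_{\mathcal{M}}}$ are their respective $r$-th largest singular values.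
   Context: $\|\cdot\|_F$ and $\|\cdot\|_2$ are the Frobenius and spectral norms. The sampling operator $P_\Omega$ is defined by $[P_\Omega(X)]_{i,j}=X_{i,j}$ if $(i,j)\in\Omega$ and $0$ otherwise. The quantity $\tau(\Omega)$ is $$\tau(\Omega)=\left|\frac{1}{\sqrt{|\Omega|}}\|P_\Omega(\widehat{Y}-Y^* )\|_F-\frac{1}{\sqrt{mn}}\|\widehat{Y}-Y^*\|_F\right|.$$ For a subspace $\mathcal{S}$, $\mathbb{P}^{\mathcal{S}}$ denotes the orthogonal projection onto $\mathcal{S}$ and $\mathbb{P}^{\mathcal{S}^\perp}=I-\mathbb{P}^{\mathcal{S}}$. The column spaces are subspaces of $\mathbb{R}^m$ and the row spaces are subspaces of $\mathbb{R}^n$. For two $r$-dimensional subspaces with orthonormal basis matrices $A,B$ (having $r$ orthonormal columns each), the canonical angle matrix is the $r\times r$ diagonal matrix with $i$-th diagonal entry $\theta_i=\arccos\sigma_i(A^TB)$, where $\sigma_i$ denotes the $i$-th singular value, and $\sin$ of this matrix is the diagonal matrix with entries $\sin\theta_i$. *)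

theory Defs
  imports "HOL-Analysis.Analysis" "HOL-Computational_Algebra.Polynomial"
begin

text \<open>An \<open>m \<times> n\<close> matrix has type \<open>real^'n^'m\<close>. On this type the library norm is the Frobenius
  norm (see \<open>frobenius_norm_eq\<close>).\<close>

abbreviation frobenius_norm :: "real^'n^'m \<Rightarrow> real"
  where "frobenius_norm A \<equiv> norm A"

lemma frobenius_norm_eq: "frobenius_norm A = sqrt (\<Sum>i\<in>UNIV. \<Sum>j\<in>UNIV. (A $ i $ j)\<^sup>2)"
  by (simp add: norm_vec_def L2_set_def sum_nonneg)

definition spectral_norm :: "real^'n^'m \<Rightarrow> real"
  where "spectral_norm A = onorm (\<lambda>x. A *v x)"

definition characteristic_poly :: "real^'n^'n \<Rightarrow> real poly"
  where "characteristic_poly A = det (mat [:0, 1:] - (\<chi> i j. [:A $ i $ j:]))"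

text \<open>The square roots of the eigenvalues of \<open>A\<^sup>T A\<close>, with multiplicity and in decreasing order.
  The list has one entry per column of \<open>A\<close>; a wide matrix thus has extra zeros at the end,
  after its first \<open>min m n\<close> singular values.\<close>

definition singular_values :: "real^'n^'m \<Rightarrow> real list"
  where "singular_values A =
    map sqrt (rev (sorted_list_of_multiset (proots (characteristic_poly (transpose A ** A)))))"

text \<open>Counting starts at 1: \<open>singular_value A 1\<close> is the largest.\<close>

definition singular_value :: "real^'n^'m \<Rightarrow> nat \<Rightarrow> real"
  where "singular_value A i = singular_values A ! (i - 1)"

definition column_space :: "real^'n^'m \<Rightarrow> (real^'m) set"
  where "column_space A = span (columns A)"

definition row_space :: "real^'n^'m \<Rightarrow> (real^'n) set"
  where "row_space A = span (rows A)"

text \<open>Meant for subspaces \<open>S\<close>, where the described vector exists and is unique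
  (\<open>orth_proj_well_defined\<close>).\<close>

definition orth_proj :: "(real^'m) set \<Rightarrow> real^'m^'m"
  where "orth_proj S = matrix (\<lambda>x. THE y. y \<in> S \<and> x - y \<in> S\<^sup>\<bottom>)"

definition orth_proj_compl :: "(real^'m) set \<Rightarrow> real^'m^'m"
  where "orth_proj_compl S = mat 1 - orth_proj S"

lemma orth_proj_well_defined:
  fixes S :: "(real^'m) set"
  assumes "subspace S"
  shows "\<exists>!y. y \<in> S \<and> x - y \<in> S\<^sup>\<bottom>"
proof (rule ex_ex1I)
  have "x \<in> S + S\<^sup>\<bottom>"
    using subspace_sum_orthogonal_comp[OF assms] by simp
  then obtain y z where "y \<in> S" "z \<in> S\<^sup>\<bottom>" "x = y + z"
    by (auto elim: set_plus_elim)
  then show "\<exists>y. y \<in> S \<and> x - y \<in> S\<^sup>\<bottom>"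
    by auto
next
  fix y y' assume y: "y \<in> S \<and> x - y \<in> S\<^sup>\<bottom>" and y': "y' \<in> S \<and> x - y' \<in> S\<^sup>\<bottom>"
  have "y - y' \<in> S"
    using y y' assms by (simp add: subspace_diff)
  moreover have "y - y' \<in> S\<^sup>\<bottom>"
    using subspace_diff[OF subspace_orthogonal_comp, of "x - y'" S "x - y"] y y' by simp
  ultimately have "orthogonal (y - y') (y - y')"
    by (auto simp: orthogonal_comp_def)
  then show "y = y'"
    by (simp add: orthogonal_def)
qed

definition orthonormal_basis_matrix :: "real^'r^'m \<Rightarrow> (real^'m) set \<Rightarrow> bool"
  where "orthonormal_basis_matrix A S \<longleftrightarrow> transpose A ** A = mat 1 \<and> column_space A = S"

text \<open>A linear order on the index type \<open>'r\<close> is used only to enumerate it: the element at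
  position \<open>i\<close> carries the \<open>i\<close>-th canonical angle.\<close>

definition index_pos :: "'r::{finite,linorder} \<Rightarrow> nat"
  where "index_pos i = card {j. j \<le> i}"

text \<open>The matrix of canonical angles does not depend on the orthonormal bases.\<close>

definition is_canonical_angle_matrix ::
    "(real^'m) set \<Rightarrow> (real^'m) set \<Rightarrow> real^('r::{finite,linorder})^('r::{finite,linorder}) \<Rightarrow> bool"
  where "is_canonical_angle_matrix S T \<Theta> \<longleftrightarrow>
    (\<exists>(A :: real^('r::{finite,linorder})^'m) (B :: real^('r::{finite,linorder})^'m).
       orthonormal_basis_matrix A S \<and> orthonormal_basis_matrix B T \<and>
       \<Theta> = (\<chi> i j. if i = j then arccos (singular_value (transpose A ** B) (index_pos i)) else 0))"

definition sin_diag :: "real^'r^'r \<Rightarrow> real^'r^'r"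
  where "sin_diag \<Theta> = (\<chi> i j. if i = j then sin (\<Theta> $ i $ i) else 0)"

definition sampling :: "('m \<times> 'n) set \<Rightarrow> real^'n^'m \<Rightarrow> real^'n^'m"
  where "sampling \<Omega> X = (\<chi> i j. if (i, j) \<in> \<Omega> then X $ i $ j else 0)"

definition tau :: "('m \<times> 'n) set \<Rightarrow> real^'n^'m \<Rightarrow> real^'n^'m \<Rightarrow> real"
  where "tau \<Omega> Yhat Ystar =
    \<bar>1 / sqrt (card \<Omega>) * frobenius_norm (sampling \<Omega> (Yhat - Ystar))
      - 1 / sqrt (real CARD('m) * real CARD('n)) * frobenius_norm (Yhat - Ystar)\<bar>"

definition feasible :: "real \<Rightarrow> real^'r^'m \<Rightarrow> real^'r^'n \<Rightarrow> bool"
  where "feasible k U V \<longleftrightarrow> (\<forall>i j. \<bar>(U ** transpose V) $ i $ j\<bar> \<le> k)"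

definition objective :: "('m \<times> 'n) set \<Rightarrow> real^'n^'m \<Rightarrow> real^'r^'m \<Rightarrow> real^'r^'n \<Rightarrow> real"
  where "objective \<Omega> Yhat U V = 1 / 2 * (frobenius_norm (sampling \<Omega> (U ** transpose V - Yhat)))\<^sup>2"

definition global_optimum ::
    "real \<Rightarrow> ('m \<times> 'n) set \<Rightarrow> real^'n^'m \<Rightarrow> real^'r^'m \<Rightarrow> real^'r^'n \<Rightarrow> bool"
  where "global_optimum k \<Omega> Yhat U V \<longleftrightarrow>
    feasible k U V \<and>
    (\<forall>(U' :: real^'r^'m) (V' :: real^'r^'n). feasible k U' V' \<longrightarrow> objective \<Omega> Yhat U V \<le> objective \<Omega> Yhat U' V')"

end

theory Submission
  imports Defs
begin

text \<open>Take \<open>\<Delta> = Y\<^sup>* - Y\<close>. As \<open>Y\<close> is feasible, optimality of \<open>Y\<^sup>*\<close> gives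
  \<open>\<parallel>P\<^sub>\<Omega>(Y\<^sup>* - (Y + E))\<parallel>\<^sub>F \<le> \<parallel>P\<^sub>\<Omega> E\<parallel>\<^sub>F\<close>; the definition of \<open>\<tau>\<close> turns this into a bound on the full norm.
  The bounds on \<open>\<delta>\<close> are instances of Weyl's inequality, since
  \<open>Y\<^sup>* - (Y + P\<^sub>N \<Delta>)\<close> is \<open>\<Delta> - P\<^sub>N \<Delta>\<close>.

  For the angles, let \<open>A\<close> and \<open>B\<close> be orthonormal bases of \<open>N\<^sup>*\<close> and \<open>N\<close> and \<open>Q = 1 - B B\<^sup>T\<close>. Since
  \<open>Q Y = 0\<close>, we have \<open>Q \<Delta> = Q Y\<^sup>* = (Q A)(A\<^sup>T Y\<^sup>*)\<close>. The second factor has smallest singular value \<open>\<delta>\<close>, and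
  \<open>(Q A)\<^sup>T(Q A) = 1 - (A\<^sup>T B)(A\<^sup>T B)\<^sup>T\<close> shows that \<open>Q A\<close> has the same Frobenius and spectral norms as
  \<open>sin \<Theta>\<close>. This gives the bound even without the factor \<open>\<surd>2\<close>.\<close>

text \<open>As a simp rule it would rewrite \<open>transpose A *v x\<close> to
  \<open>x v* A\<close>, after which the adjoint identity and the associativity rules used
  throughout no longer match.\<close>

declare transpose_matrix_vector [simp del]

subsection \<open>The spectral theorem for symmetric matrices\<close>

text \<open>The unit sphere of \<open>S\<close> is compact, so the Rayleigh quotient attains a
  maximum there. Working in an invariant subspace rather than the whole space is what the induction
  in \<open>self_adjoint_eigenbasis\<close> requires.\<close>

lemma self_adjoint_eigenvector_exists:
  fixes f :: "'a::euclidean_space \<Rightarrow> 'a"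
  assumes f: "linear f" and adj: "\<And>x y. f x \<bullet> y = x \<bullet> f y"
    and S: "subspace S" "f ` S \<subseteq> S" "S \<noteq> {0}"
  obtains v c where "v \<in> S" "norm v = 1" "f v = c *\<^sub>R v"
proof -
  interpret f: linear f by fact
  let ?K = "S \<inter> sphere 0 1"
  obtain x where x: "x \<in> S" "x \<noteq> 0"
    using S(1,3) subspace_0 by blast
  then have "x /\<^sub>R norm x \<in> ?K"
    using S(1) by (simp add: subspace_scale)
  moreover have "compact ?K"
    by (simp add: S(1) closed_Int_compact closed_subspace)
  moreover have "continuous_on ?K (\<lambda>x. x \<bullet> f x)"
    by (intro continuous_intros linear_continuous_on linear_conv_bounded_linear[THEN iffD1] f)
  ultimately obtain v where v: "v \<in> ?K" and max: "\<And>y. y \<in> ?K \<Longrightarrow> y \<bullet> f y \<le> v \<bullet> f v"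
    using continuous_attains_sup[of ?K "\<lambda>x. x \<bullet> f x"] by blast
  define c where "c = v \<bullet> f v"
  have nonneg: "y \<bullet> f y \<le> c * (y \<bullet> y)" if "y \<in> S" for y
  proof (cases "y = 0")
    case False
    then have "(y /\<^sub>R norm y) \<bullet> f (y /\<^sub>R norm y) \<le> c"
      unfolding c_def using that S(1) by (intro max) (simp add: subspace_scale)
    with False show ?thesis
      by (simp add: f.scale divide_simps dot_square_norm power2_eq_square)
  qed simp
  \<comment> \<open>Half the gradient at \<open>v\<close> of the form
    \<open>c * (y \<bullet> y) - y \<bullet> f y\<close>, which is nonnegative on \<open>S\<close>
    and vanishes at \<open>v\<close>.\<close>
  define w where "w = c *\<^sub>R v - f v"
  have vv: "v \<bullet> v = 1" "v \<in> S" using v by (auto simp: dot_square_norm)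
  have w: "w \<in> S"
    unfolding w_def using vv S by (auto intro!: subspace_diff subspace_scale)
  define b where "b = w \<bullet> w"
  define g where "g = c * (w \<bullet> w) - w \<bullet> f w"
  txt \<open>\<open>v\<close> maximises the Rayleigh quotient on \<open>S\<close>; moving from \<open>v\<close> along \<open>w\<close> forces \<open>w = 0\<close>.\<close>
  have quad: "0 \<le> 2 * t * b + t\<^sup>2 * g" for t
  proof -
    have "v + t *\<^sub>R w \<in> S" using vv w S(1) by (simp add: subspace_add subspace_scale)
    from nonneg[OF this] have "0 \<le> c * ((v + t *\<^sub>R w) \<bullet> (v + t *\<^sub>R w)) - (v + t *\<^sub>R w) \<bullet> f (v + t *\<^sub>R w)"
      by simp
    also have "\<dots> = c * (v \<bullet> v) - v \<bullet> f v + 2 * t * (c * (v \<bullet> w) - w \<bullet> f v) + t\<^sup>2 * g"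
      using adj[of v w]
      by (simp add: g_def f.add f.scale inner_add_left inner_add_right inner_commute[of w v] inner_commute[of "f v" w]
          power2_eq_square algebra_simps)
    also have "c * (v \<bullet> w) - w \<bullet> f v = b"
      by (simp add: b_def w_def inner_diff_left inner_diff_right inner_commute algebra_simps)
    finally show ?thesis using vv by (simp add: c_def)
  qed
  have "b = 0"
  proof (rule ccontr)
    assume "b \<noteq> 0"
    then have b: "b > 0" by (simp add: b_def)
    have g: "g \<ge> 0" using nonneg[OF w] by (simp add: g_def)
    \<comment> \<open>A step of length \<open>u\<close> against the gradient makes the quadratic
      negative; the summand 1 keeps the denominator positive when \<open>g = 0\<close>.\<close>
    define u where "u = b / (g + 1)"
    have u: "b = u * (g + 1)" "u > 0" using b g by (auto simp: u_def)
    have "2 * (- u) * b + (- u)\<^sup>2 * g = - (u\<^sup>2 * (g + 2))"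
      by (simp add: u(1) power2_eq_square algebra_simps)
    moreover have "u\<^sup>2 * (g + 2) > 0"
      using u(2) g by (intro mult_pos_pos) auto
    ultimately show False using quad[of "- u"] by linarith
  qed
  then have "f v = c *\<^sub>R v" by (simp add: b_def w_def)
  with that vv v show thesis by auto
qed

text \<open>Induction on the dimension: split off one unit eigenvector \<open>v\<close>.
  Self-adjointness makes its orthogonal complement within \<open>S\<close> invariant again, and that
  complement has smaller dimension.\<close>

lemma self_adjoint_eigenbasis:
  fixes f :: "'a::euclidean_space \<Rightarrow> 'a"
  assumes f: "linear f" and adj: "\<And>x y. f x \<bullet> y = x \<bullet> f y"
    and S: "subspace S" "f ` S \<subseteq> S"
  shows "\<exists>B. finite B \<and> pairwise orthogonal B \<and> (\<forall>b\<in>B. norm b = 1 \<and> (\<exists>c. f b = c *\<^sub>R b)) \<and> span B = S"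
  using S
proof (induction "dim S" arbitrary: S rule: less_induct)
  case less
  interpret f: linear f by fact
  show ?case
  proof (cases "S = {0}")
    case True
    then show ?thesis by (intro exI[of _ "{}"]) auto
  next
    case False
    then obtain v c where v: "v \<in> S" "norm v = 1" "f v = c *\<^sub>R v"
      using self_adjoint_eigenvector_exists[OF f adj less.prems] by blast
    define S' where "S' = S \<inter> {x. orthogonal v x}"
    have vv: "v \<bullet> v = 1" using v by (simp add: dot_square_norm)
    have sub': "subspace S'"
      unfolding S'_def by (intro subspace_inter less.prems subspace_orthogonal_to_vector)
    have "v \<notin> S'" using vv by (auto simp: S'_def orthogonal_def)
    then have "span S' \<subset> span S"
      using v sub' less.prems(1) by (auto simp: span_eq_iff[THEN iffD2] S'_def)
    then have "dim S' < dim S" by (rule dim_psubset)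
    moreover have "f ` S' \<subseteq> S'"
    proof -
      have "v \<bullet> f x = 0" if "v \<bullet> x = 0" for x
        using adj[of v x] v that by simp
      then show ?thesis using less.prems(2) by (auto simp: S'_def orthogonal_def)
    qed
    ultimately obtain B where B: "finite B" "pairwise orthogonal B"
      "\<forall>b\<in>B. norm b = 1 \<and> (\<exists>c. f b = c *\<^sub>R b)" "span B = S'"
      using less.hyps sub' by blast
    have orth: "orthogonal v b" if "b \<in> B" for b
      using that B(4) span_base by (fastforce simp: S'_def)
    have "span (insert v B) = S"
    proof
      show "span (insert v B) \<subseteq> S"
        using B(4) v less.prems(1) span_superset[of B] by (intro span_minimal) (auto simp: S'_def)
    next
      show "S \<subseteq> span (insert v B)"
      proof
        fix x assume x: "x \<in> S"
        have "x - (v \<bullet> x) *\<^sub>R v \<in> S'"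
          using x v vv less.prems(1)
          by (auto simp: S'_def orthogonal_def inner_diff_right subspace_diff subspace_scale)
        then show "x \<in> span (insert v B)"
          unfolding span_breakdown_eq using B(4) by blast
      qed
    qed
    moreover have "pairwise orthogonal (insert v B)"
      using B(2) orth by (auto simp: pairwise_insert orthogonal_commute)
    ultimately show ?thesis
      using B v by (intro exI[of _ "insert v B"]) auto
  qed
qed

lemma inner_matrix_transpose: "(A *v x) \<bullet> y = x \<bullet> (transpose A *v y)" for A :: "real^'n^'m"
  by (metis dot_lmul_matrix inner_commute transpose_matrix_vector)

text \<open>An eigenbasis of the whole space has \<open>CARD('n)\<close> elements, so it can be
  indexed by \<open>'n\<close> itself. The eigenvectors can then serve as the columns of a square
  matrix.\<close>

lemma symmetric_matrix_eigenbasis: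
  fixes M :: "real^'n^'n"
  assumes "transpose M = M"
  obtains v :: "'n \<Rightarrow> real^'n" and d
  where "\<And>i j. v i \<bullet> v j = (if i = j then 1 else 0)" "\<And>i. M *v v i = d i *\<^sub>R v i"
proof -
  have "(M *v x) \<bullet> y = x \<bullet> (M *v y)" for x y
    using assms by (simp add: inner_matrix_transpose)
  then obtain B where B: "finite B" "pairwise orthogonal B"
    "\<forall>b\<in>B. norm b = 1 \<and> (\<exists>c. M *v b = c *\<^sub>R b)" "span B = UNIV"
    using self_adjoint_eigenbasis[of "(*v) M" UNIV] by auto
  have "independent B"
    using B by (intro pairwise_orthogonal_independent) auto
  then have "card B = CARD('n)"
    using indep_card_eq_dim_span[of B] B(4) by simp
  then obtain v where v: "bij_betw v (UNIV::'n set) B"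
    using B(1) finite_same_card_bij[of "UNIV :: 'n set" B] by auto
  have "\<forall>i. \<exists>c. M *v v i = c *\<^sub>R v i"
    using B(3) v by (auto simp: bij_betw_def)
  then obtain d where d: "\<And>i. M *v v i = d i *\<^sub>R v i" by metis
  have "v i \<bullet> v j = (if i = j then 1 else 0)" for i j
  proof (cases "i = j")
    case True
    then show ?thesis using B(3) v by (auto simp: bij_betw_def dot_square_norm)
  next
    case False
    then have "v i \<noteq> v j" "v i \<in> B" "v j \<in> B" using v by (auto simp: bij_betw_def inj_on_def)
    then show ?thesis using B(2) False by (auto simp: pairwise_def orthogonal_def)
  qed
  with d that show thesis by blast
qed

section \<open>Eigenvalues as roots of the characteristic polynomial\<close>

lemma matrix_diff_ldistrib: "A ** (B - C) = A ** B - A ** C" for A :: "'a::ring_1^'n^'m"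
  by (simp add: vec_eq_iff matrix_matrix_mult_def right_diff_distrib sum_subtractf)

lemma matrix_diff_rdistrib: "(A - B) ** C = A ** C - B ** C" for A :: "'a::ring_1^'n^'m"
  by (simp add: vec_eq_iff matrix_matrix_mult_def left_diff_distrib sum_subtractf)

lemma mat_mult_commute: "mat c ** A = A ** mat c" for A :: "'a::comm_ring_1^'n^'n"
  by (simp add: vec_eq_iff matrix_matrix_mult_def mat_def if_distrib sum.delta sum.delta'
      mult.commute if_distribR cong: if_cong)

text \<open>With \<open>P\<close> the orthogonal matrix of eigenvectors, (x - M) P = P D for the
  diagonal matrix D with entries x - d_i. Taking determinants and cancelling det P factors the
  polynomial, multiplicities included. This links the algebraic definition of singular values to
  eigenvectors.\<close>

lemma proots_characteristic_poly_eigenbasis: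
  fixes M :: "real^'n^'n" and v :: "'n \<Rightarrow> real^'n"
  assumes v: "\<And>i j. v i \<bullet> v j = (if i = j then 1 else 0)"
    and d: "\<And>i. M *v v i = d i *\<^sub>R v i"
  shows "proots (characteristic_poly M) = image_mset d (mset_set UNIV)"
proof -
  \<comment> \<open>Embeds real matrices as matrices of constant polynomials, so that
    \<open>M\<close> and \<open>P\<close> can be multiplied with matrices containing the
    indeterminate.\<close>
  let ?C = "map_matrix (\<lambda>a. [:a:]) :: real^'n^'n \<Rightarrow> real poly^'n^'n"
  define P :: "real^'n^'n" where "P = (\<chi> i j. v j $ i)"
  have Cmult: "?C (A ** B) = ?C A ** ?C B" for A B
  proof -
    have "[:sum g S:] = (\<Sum>i\<in>S. [:g i:])" for g :: "'n \<Rightarrow> real" and S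
    proof (induction S rule: infinite_finite_induct)
      case (insert i S)
      then show ?case by (simp flip: insert.IH)
    qed auto
    then show ?thesis
      by (simp add: vec_eq_iff matrix_matrix_mult_def mult.commute)
  qed
  have Cone: "?C (mat 1) = mat 1"
    by (simp add: vec_eq_iff mat_def one_pCons)
  have PP: "transpose P ** P = mat 1"
    using v by (simp add: P_def vec_eq_iff matrix_matrix_mult_def transpose_def mat_def inner_vec_def)
  have MP: "M ** P = P ** (\<chi> i j. if i = j then d i else 0)"
    using d by (simp add: P_def vec_eq_iff matrix_matrix_mult_def matrix_vector_mult_def if_distrib sum.delta
        mult.commute cong: if_cong)
  let ?D = "\<chi> i j. if i = j then [:- d i, 1:] else 0"
  have "(mat [:0, 1:] - ?C M) ** ?C P = ?C P ** ?D"
  proof -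
    have "?C M ** ?C P = ?C P ** ?C (\<chi> i j. if i = j then d i else 0)"
      using MP by (metis Cmult)
    moreover have "?D = mat [:0, 1:] - ?C (\<chi> i j. if i = j then d i else 0)"
      by (simp add: vec_eq_iff mat_def)
    ultimately show ?thesis
      by (simp add: matrix_diff_ldistrib matrix_diff_rdistrib mat_mult_commute)
  qed
  then have "det (mat [:0, 1:] - ?C M) * det (?C P) = det (?C P) * det ?D"
    by (simp flip: det_mul)
  moreover have "det (?C P) \<noteq> 0"
  proof
    assume "det (?C P) = 0"
    then have "det (?C (transpose P) ** ?C P) = 0" by (simp add: det_mul)
    then show False by (simp add: PP Cone flip: Cmult)
  qed
  ultimately have "det (mat [:0, 1:] - ?C M) = det ?D" by simp
  moreover have "?C M = (\<chi> i j. [:M $ i $ j:])" by (simp add: vec_eq_iff)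
  ultimately have "characteristic_poly M = (\<Prod>i\<in>UNIV. [:- d i, 1:])"
    by (simp add: characteristic_poly_def det_diagonal)
  moreover have "(\<Sum>i\<in>S. {#d i#}) = image_mset d (mset_set S)" if "finite S" for S
    using that by (induction S) auto
  ultimately show ?thesis
    by (simp add: proots_prod)
qed

subsection \<open>Singular values\<close>

lemma span_orthonormal_family:
  fixes v :: "'i::finite \<Rightarrow> 'a::euclidean_space"
  assumes v: "\<And>i j. v i \<bullet> v j = (if i = j then 1 else 0)" and x: "x \<in> span (v ` I)"
  shows "x = (\<Sum>i\<in>I. (v i \<bullet> x) *\<^sub>R v i)"
proof -
  have inj: "inj_on v I" using v by (metis inj_onI zero_neq_one)
  obtain u where "x = (\<Sum>a\<in>v ` I. u a *\<^sub>R a)"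
    using x span_finite[of "v ` I"] by auto
  then have u: "x = (\<Sum>i\<in>I. u (v i) *\<^sub>R v i)"
    using inj by (simp add: sum.reindex)
  have "v i \<bullet> x = u (v i)" if "i \<in> I" for i
    using that by (simp add: u inner_sum_right v if_distrib sum.delta' cong: if_cong)
  then show ?thesis using u by simp
qed

lemma norm_orthonormal_sum:
  fixes v :: "'i::finite \<Rightarrow> 'a::euclidean_space"
  assumes v: "\<And>i j. v i \<bullet> v j = (if i = j then 1 else 0)"
  shows "(norm (\<Sum>i\<in>I. c i *\<^sub>R v i))\<^sup>2 = (\<Sum>i\<in>I. (c i)\<^sup>2)"
  unfolding power2_norm_eq_inner
  by (simp add: inner_sum_left inner_sum_right v if_distrib sum.delta' power2_eq_square cong: if_cong)

lemma dim_span_orthonormal_family: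
  fixes v :: "'i::finite \<Rightarrow> 'a::euclidean_space"
  assumes v: "\<And>i j. v i \<bullet> v j = (if i = j then 1 else 0)"
  shows "dim (span (v ` I)) = card I"
proof -
  have "inj_on v I" using v by (metis inj_onI zero_neq_one)
  moreover have "independent (v ` I)"
    using v by (intro pairwise_orthogonal_independent)
      (auto simp: pairwise_def orthogonal_def, metis inner_zero_left zero_neq_one)
  ultimately show ?thesis
    by (simp add: dim_eq_card_independent card_image)
qed

lemma length_sorted_list_of_multiset: "length (sorted_list_of_multiset M) = size M"
  by (metis mset_sorted_list_of_multiset size_mset)

text \<open>Position \<open>k\<close> counts from 0 in a decreasing list: positions 0 to
  \<open>k\<close> carry values at least \<open>xs ! k\<close>, positions from \<open>k\<close> on
  carry values at most \<open>xs ! k\<close>. Ties can only enlarge both sets.\<close>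

lemma card_filter_sorted_image:
  fixes d :: "'i::finite \<Rightarrow> 'b::linorder"
  defines "xs \<equiv> rev (sorted_list_of_multiset (image_mset d (mset_set UNIV)))"
  assumes k: "k < CARD('i)"
  shows "k < card {i. xs ! k \<le> d i}" "CARD('i) - k \<le> card {i. d i \<le> xs ! k}"
proof -
  have m: "mset xs = image_mset d (mset_set UNIV)" by (simp add: xs_def)
  have len: "length xs = CARD('i)" by (simp add: xs_def length_sorted_list_of_multiset)
  \<comment> \<open>Equality of multisets transfers counting over indices to counting over list
    positions.\<close>
  have cnt: "card {i. P (d i)} = card {j. j < length xs \<and> P (xs ! j)}" for P
  proof -
    have "card {j. j < length xs \<and> P (xs ! j)} = size (filter_mset P (mset xs))"
      by (metis length_filter_conv_card mset_filter size_mset)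
    also have "\<dots> = card {i. P (d i)}"
      by (simp add: m filter_mset_image_mset filter_mset_mset_set)
    finally show ?thesis by simp
  qed
  have desc: "xs ! j \<le> xs ! i" if "i \<le> j" "j < length xs" for i j
  proof -
    have "sorted (rev xs)" by (simp add: xs_def)
    then show ?thesis using that by (auto simp: sorted_rev_iff_nth_mono)
  qed
  have "{..k} \<subseteq> {j. j < length xs \<and> xs ! k \<le> xs ! j}"
    using k len desc by auto
  from card_mono[OF _ this] show "k < card {i. xs ! k \<le> d i}"
    by (simp add: cnt[of "\<lambda>y. xs ! k \<le> y"])
  have "{k..<length xs} \<subseteq> {j. j < length xs \<and> xs ! j \<le> xs ! k}"
    using desc by auto
  from card_mono[OF _ this] show "CARD('i) - k \<le> card {i. d i \<le> xs ! k}"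
    by (simp add: len cnt[of "\<lambda>y. y \<le> xs ! k"])
qed

text \<open>The norm formulas are given on spans of subfamilies because the Courant-Fischer
  arguments use only the eigenvectors with large, or only those with small, eigenvalues.\<close>

lemma gram_eigenbasis:
  fixes A :: "real^'n^'m"
  obtains v :: "'n \<Rightarrow> real^'n" and d
  where "\<And>i j. v i \<bullet> v j = (if i = j then 1 else 0)"
    "\<And>I x. x \<in> span (v ` I) \<Longrightarrow> (norm x)\<^sup>2 = (\<Sum>i\<in>I. (v i \<bullet> x)\<^sup>2)"
    "\<And>I x. x \<in> span (v ` I) \<Longrightarrow> (norm (A *v x))\<^sup>2 = (\<Sum>i\<in>I. d i * (v i \<bullet> x)\<^sup>2)"
    "singular_values A = map sqrt (rev (sorted_list_of_multiset (image_mset d (mset_set UNIV))))"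
proof -
  let ?M = "transpose A ** A"
  have "transpose ?M = ?M" by (simp add: matrix_transpose_mul)
  then obtain v :: "'n \<Rightarrow> real^'n" and d where v: "\<And>i j. v i \<bullet> v j = (if i = j then 1 else 0)"
    and d: "\<And>i. ?M *v v i = d i *\<^sub>R v i"
    using symmetric_matrix_eigenbasis by blast
  show thesis
  proof (rule that)
    show "v i \<bullet> v j = (if i = j then 1 else 0)" for i j by (rule v)
    show "singular_values A = map sqrt (rev (sorted_list_of_multiset (image_mset d (mset_set UNIV))))"
      by (simp add: singular_values_def proots_characteristic_poly_eigenbasis[OF v d])
    fix I x assume x: "x \<in> span (v ` I)"
    note x_eq = span_orthonormal_family[OF v x]
    show "(norm x)\<^sup>2 = (\<Sum>i\<in>I. (v i \<bullet> x)\<^sup>2)"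
      by (subst x_eq) (rule norm_orthonormal_sum[OF v])
    have "(norm (A *v x))\<^sup>2 = x \<bullet> (?M *v x)"
      by (simp add: power2_norm_eq_inner inner_matrix_transpose matrix_vector_mul_assoc)
    also have "?M *v x = (\<Sum>i\<in>I. (d i * (v i \<bullet> x)) *\<^sub>R v i)"
      by (subst x_eq)
        (simp add: linear_sum[OF matrix_vector_mul_linear] o_def matrix_vector_mult_scaleR d mult.commute)
    also have "x \<bullet> \<dots> = (\<Sum>i\<in>I. d i * (v i \<bullet> x)\<^sup>2)"
      by (simp add: inner_sum_right power2_eq_square inner_commute mult.assoc)
    finally show "(norm (A *v x))\<^sup>2 = (\<Sum>i\<in>I. d i * (v i \<bullet> x)\<^sup>2)" .
  qed
qed

text \<open>The two halves of the Courant--Fischer characterisation.\<close>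

lemma singular_value_subspace:
  fixes A :: "real^'n^'m"
  assumes k: "1 \<le> k" "k \<le> CARD('n)"
  obtains S where "subspace S" "k \<le> dim S" "\<And>x. x \<in> S \<Longrightarrow> singular_value A k * norm x \<le> norm (A *v x)"
proof -
  obtain v :: "'n \<Rightarrow> real^'n" and d where v: "\<And>i j. v i \<bullet> v j = (if i = j then 1 else 0)"
    and nx: "\<And>I x. x \<in> span (v ` I) \<Longrightarrow> (norm x)\<^sup>2 = (\<Sum>i\<in>I. (v i \<bullet> x)\<^sup>2)"
    and nA: "\<And>I x. x \<in> span (v ` I) \<Longrightarrow> (norm (A *v x))\<^sup>2 = (\<Sum>i\<in>I. d i * (v i \<bullet> x)\<^sup>2)"
    and sv: "singular_values A = map sqrt (rev (sorted_list_of_multiset (image_mset d (mset_set UNIV))))"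
    by (rule gram_eigenbasis[of A]) (rule that)
  define s where "s = rev (sorted_list_of_multiset (image_mset d (mset_set UNIV))) ! (k - 1)"
  have s: "singular_value A k = sqrt s"
    using k by (simp add: singular_value_def sv s_def length_sorted_list_of_multiset)
  \<comment> \<open>At least \<open>k\<close> eigenvectors qualify, and on their span the Gram form
    is at least \<open>s\<close> times the squared norm.\<close>
  let ?I = "{i. s \<le> d i}"
  show thesis
  proof (rule that)
    show "subspace (span (v ` ?I))" by simp
    show "k \<le> dim (span (v ` ?I))"
      unfolding dim_span_orthonormal_family[OF v]
      using card_filter_sorted_image(1)[of "k - 1" d, folded s_def] k by linarith
    fix x assume x: "x \<in> span (v ` ?I)"
    have "s * (norm x)\<^sup>2 \<le> (norm (A *v x))\<^sup>2"
      unfolding nx[OF x] nA[OF x] sum_distrib_left by (intro sum_mono mult_right_mono) auto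
    then have "sqrt (s * (norm x)\<^sup>2) \<le> norm (A *v x)"
      by (intro real_le_lsqrt) auto
    then show "singular_value A k * norm x \<le> norm (A *v x)"
      by (simp add: s real_sqrt_mult)
  qed
qed

lemma singular_value_ge:
  fixes A :: "real^'n^'m"
  assumes k: "1 \<le> k" "k \<le> CARD('n)" and S: "subspace S" "k \<le> dim S"
    and t: "\<And>x. x \<in> S \<Longrightarrow> t * norm x \<le> norm (A *v x)"
  shows "t \<le> singular_value A k"
proof -
  obtain v :: "'n \<Rightarrow> real^'n" and d where v: "\<And>i j. v i \<bullet> v j = (if i = j then 1 else 0)"
    and nx: "\<And>I x. x \<in> span (v ` I) \<Longrightarrow> (norm x)\<^sup>2 = (\<Sum>i\<in>I. (v i \<bullet> x)\<^sup>2)"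
    and nA: "\<And>I x. x \<in> span (v ` I) \<Longrightarrow> (norm (A *v x))\<^sup>2 = (\<Sum>i\<in>I. d i * (v i \<bullet> x)\<^sup>2)"
    and sv: "singular_values A = map sqrt (rev (sorted_list_of_multiset (image_mset d (mset_set UNIV))))"
    by (rule gram_eigenbasis[of A]) (rule that)
  define s where "s = rev (sorted_list_of_multiset (image_mset d (mset_set UNIV))) ! (k - 1)"
  have s: "singular_value A k = sqrt s"
    using k by (simp add: singular_value_def sv s_def length_sorted_list_of_multiset)
  \<comment> \<open>This span has dimension at least n - k + 1, so it meets \<open>S\<close> in a
    nonzero vector, where the lower bound \<open>t\<close> and the upper bound \<open>sqrt s\<close>
    confront each other.\<close>
  let ?T = "span (v ` {i. d i \<le> s})"
  have "CARD('n) - (k - 1) \<le> dim ?T"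
    unfolding dim_span_orthonormal_family[OF v]
    using card_filter_sorted_image(2)[of "k - 1" d] k by (simp add: s_def)
  moreover have "dim {x + y |x y. x \<in> S \<and> y \<in> ?T} + dim (S \<inter> ?T) = dim S + dim ?T"
    using S by (intro dim_sums_Int) auto
  moreover have "dim {x + y |x y. x \<in> S \<and> y \<in> ?T} \<le> CARD('n)"
    by (rule dim_subset_UNIV_cart)
  ultimately have "dim (S \<inter> ?T) \<noteq> 0" using S(2) k by linarith
  then obtain x where x: "x \<in> S" "x \<in> ?T" "x \<noteq> 0"
    by auto
  have "(norm (A *v x))\<^sup>2 \<le> s * (norm x)\<^sup>2"
    unfolding nx[OF x(2)] nA[OF x(2)] sum_distrib_left by (intro sum_mono mult_right_mono) auto
  from real_sqrt_le_mono[OF this] have "norm (A *v x) \<le> sqrt s * norm x"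
    by (simp add: real_sqrt_mult)
  with t[OF x(1)] have "t * norm x \<le> sqrt s * norm x" by simp
  with x show ?thesis by (simp add: s)
qed

lemma singular_value_nonneg:
  fixes A :: "real^'n^'m"
  assumes "1 \<le> k" "k \<le> CARD('n)"
  shows "0 \<le> singular_value A k"
  using assms by (intro singular_value_ge[of k UNIV]) auto

section \<open>The spectral norm and Weyl's inequality\<close>

lemma norm_matrix_vector_le: "norm (A *v x) \<le> spectral_norm A * norm x" for A :: "real^'n^'m"
  unfolding spectral_norm_def by (rule onorm) simp

lemma spectral_norm_nonneg: "0 \<le> spectral_norm A" for A :: "real^'n^'m"
  unfolding spectral_norm_def by (rule onorm_pos_le) simp

lemma spectral_norm_leI:
  fixes A :: "real^'n^'m"
  shows "0 \<le> b \<Longrightarrow> (\<And>x. norm (A *v x) \<le> b * norm x) \<Longrightarrow> spectral_norm A \<le> b"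
  unfolding spectral_norm_def by (rule onorm_bound)

text \<open>Since |A^T x|^2 = <A A^T x, x>, Cauchy-Schwarz bounds it by |A| |A^T x| |x|, and one
  factor |A^T x| cancels.\<close>

lemma spectral_norm_transpose_le: "spectral_norm (transpose A) \<le> spectral_norm A" for A :: "real^'n^'m"
proof (intro spectral_norm_leI spectral_norm_nonneg)
  fix x
  let ?y = "transpose A *v x"
  have "norm ?y * norm ?y = (A *v ?y) \<bullet> x"
    by (simp add: inner_matrix_transpose flip: dot_square_norm power2_eq_square)
  also have "\<dots> \<le> norm (A *v ?y) * norm x" by (rule norm_cauchy_schwarz)
  also have "\<dots> \<le> spectral_norm A * norm ?y * norm x"
    by (intro mult_right_mono norm_matrix_vector_le) simp
  finally have "norm ?y * norm ?y \<le> (spectral_norm A * norm x) * norm ?y" by (simp add: ac_simps)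
  then show "norm ?y \<le> spectral_norm A * norm x"
    using mult_right_le_imp_le[of "norm ?y" "norm ?y"] spectral_norm_nonneg[of A]
    by (cases "?y = 0") auto
qed

lemma spectral_norm_transpose: "spectral_norm (transpose A) = spectral_norm A" for A :: "real^'n^'m"
  using spectral_norm_transpose_le[of A] spectral_norm_transpose_le[of "transpose A"] by simp

lemma spectral_norm_minus_commute: "spectral_norm (A - B) = spectral_norm (B - A)" for A :: "real^'n^'m"
  by (simp add: spectral_norm_def matrix_vector_mult_diff_rdistrib norm_minus_commute onorm_def)

text \<open>On the subspace where \<open>A\<close> stretches by at least its \<open>k\<close>-th
  singular value, \<open>B\<close> loses at most the norm of \<open>A - B\<close>.\<close>

lemma singular_value_weyl_le:
  fixes A B :: "real^'n^'m"
  assumes k: "1 \<le> k" "k \<le> CARD('n)"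
  shows "singular_value A k - spectral_norm (A - B) \<le> singular_value B k"
proof -
  obtain S where S: "subspace S" "k \<le> dim S" "\<And>x. x \<in> S \<Longrightarrow> singular_value A k * norm x \<le> norm (A *v x)"
    by (rule singular_value_subspace[OF k, of A]) (rule that)
  show ?thesis
  proof (rule singular_value_ge[OF k S(1,2)])
    fix x assume "x \<in> S"
    have "norm (A *v x) \<le> norm (B *v x) + norm ((A - B) *v x)"
      by (simp add: matrix_vector_mult_diff_rdistrib norm_triangle_sub)
    with S(3)[OF \<open>x \<in> S\<close>] norm_matrix_vector_le[of "A - B" x]
    show "(singular_value A k - spectral_norm (A - B)) * norm x \<le> norm (B *v x)"
      by (simp add: left_diff_distrib)
  qed
qed

lemma singular_value_weyl:
  fixes A B :: "real^'n^'m"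
  assumes k: "1 \<le> k" "k \<le> CARD('n)"
  shows "\<bar>singular_value A k - singular_value B k\<bar> \<le> spectral_norm (A - B)"
  using singular_value_weyl_le[OF k, of A B] singular_value_weyl_le[OF k, of B A]
    spectral_norm_minus_commute[of A B] by linarith

section \<open>The Frobenius norm and its relation to singular values\<close>

lemma frobenius_norm_columns: "(norm A)\<^sup>2 = (\<Sum>j\<in>UNIV. (norm (A *v axis j 1))\<^sup>2)" for A :: "real^'n^'m"
proof -
  have "(norm A)\<^sup>2 = (\<Sum>i\<in>UNIV. \<Sum>j\<in>UNIV. (A $ i $ j)\<^sup>2)"
    by (simp add: frobenius_norm_eq sum_nonneg)
  also have "\<dots> = (\<Sum>j\<in>UNIV. \<Sum>i\<in>UNIV. (A $ i $ j)\<^sup>2)" by (rule sum.swap)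
  also have "\<dots> = (\<Sum>j\<in>UNIV. (norm (A *v axis j 1))\<^sup>2)"
    by (simp add: matrix_vector_mult_basis column_def norm_vec_def L2_set_def sum_nonneg)
  finally show ?thesis .
qed

lemma frobenius_norm_transpose: "norm (transpose A) = norm A" for A :: "real^'n^'m"
proof -
  have "(\<Sum>i\<in>UNIV. \<Sum>j\<in>UNIV. (A $ i $ j)\<^sup>2) = (\<Sum>j\<in>UNIV. \<Sum>i\<in>UNIV. (A $ i $ j)\<^sup>2)" by (rule sum.swap)
  then show ?thesis by (simp add: frobenius_norm_eq transpose_def)
qed

lemma spectral_norm_le_frobenius: "spectral_norm A \<le> norm A" for A :: "real^'n^'m"
proof (intro spectral_norm_leI)
  fix x
  have "norm (A *v x) = L2_set (\<lambda>i. \<bar>A $ i \<bullet> x\<bar>) UNIV"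
    by (simp add: norm_vec_def L2_set_def matrix_vector_mul_component)
  also have "\<dots> \<le> L2_set (\<lambda>i. norm (A $ i) * norm x) UNIV"
    by (intro L2_set_mono) (simp_all add: Cauchy_Schwarz_ineq2)
  finally show "norm (A *v x) \<le> norm A * norm x"
    by (simp add: norm_vec_def L2_set_left_distrib)
qed simp

text \<open>Both sides are the trace of A^T A: the eigenvalues are |A v_i|^2, and after exchanging
  sums Parseval applies to each row of \<open>A\<close>.\<close>

lemma sum_singular_values_squared:
  fixes A :: "real^'n^'m"
  shows "(\<Sum>k=1..CARD('n). (singular_value A k)\<^sup>2) = (norm A)\<^sup>2"
proof -
  obtain v :: "'n \<Rightarrow> real^'n" and d where v: "\<And>i j. v i \<bullet> v j = (if i = j then 1 else 0)"
    and nx: "\<And>I x. x \<in> span (v ` I) \<Longrightarrow> (norm x)\<^sup>2 = (\<Sum>i\<in>I. (v i \<bullet> x)\<^sup>2)"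
    and nA: "\<And>I x. x \<in> span (v ` I) \<Longrightarrow> (norm (A *v x))\<^sup>2 = (\<Sum>i\<in>I. d i * (v i \<bullet> x)\<^sup>2)"
    and sv: "singular_values A = map sqrt (rev (sorted_list_of_multiset (image_mset d (mset_set UNIV))))"
    by (rule gram_eigenbasis[of A]) (rule that)
  define xs where "xs = rev (sorted_list_of_multiset (image_mset d (mset_set UNIV)))"
  have m: "mset xs = image_mset d (mset_set UNIV)" by (simp add: xs_def)
  have len: "length xs = CARD('n)" by (simp add: xs_def length_sorted_list_of_multiset)
  have span: "span (range v) = UNIV"
    using dim_span_orthonormal_family[OF v, of UNIV] dim_eq_full[of "range v"] by simp
  \<comment> \<open>This also shows that the eigenvalues are nonnegative, so squaring undoes the
    \<open>sqrt\<close> in \<open>singular_values\<close>.\<close>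
  have d: "d i = (norm (A *v v i))\<^sup>2" for i
    using nA[of "v i" "{i}"] v[of i i] by (simp add: span_base)
  have "(\<Sum>k=1..CARD('n). (singular_value A k)\<^sup>2) = (\<Sum>k<length xs. xs ! k)"
  proof -
    have "(\<Sum>k=1..CARD('n). (singular_value A k)\<^sup>2) = (\<Sum>k<CARD('n). (singular_value A (Suc k))\<^sup>2)"
      using sum.atLeast1_atMost_eq by simp
    also have "\<dots> = (\<Sum>k<CARD('n). xs ! k)"
    proof (rule sum.cong)
      fix k assume k: "k \<in> {..<CARD('n)}"
      then have "xs ! k \<in> range d" using len m by (metis nth_mem lessThan_iff set_image_mset finite finite_set_mset_mset_set set_mset_mset)
      then have "xs ! k \<ge> 0" using d by auto
      then show "(singular_value A (Suc k))\<^sup>2 = xs ! k"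
        using k len by (simp add: singular_value_def sv flip: xs_def)
    qed simp
    finally show ?thesis by (simp add: len)
  qed
  also have "\<dots> = sum_list xs" by (simp add: sum_list_sum_nth lessThan_atLeast0)
  also have "\<dots> = (\<Sum>i\<in>UNIV. d i)"
    using m by (metis sum_mset_sum_list sum_unfold_sum_mset)
  also have "\<dots> = (\<Sum>i\<in>UNIV. \<Sum>k\<in>UNIV. (v i \<bullet> A $ k)\<^sup>2)"
    by (simp add: d norm_vec_def L2_set_def sum_nonneg matrix_vector_mul_component inner_commute)
  also have "\<dots> = (\<Sum>k\<in>UNIV. \<Sum>i\<in>UNIV. (v i \<bullet> A $ k)\<^sup>2)" by (rule sum.swap)
  also have "\<dots> = (\<Sum>k\<in>UNIV. (norm (A $ k))\<^sup>2)"
    by (simp add: nx[of _ UNIV] span)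
  also have "\<dots> = (norm A)\<^sup>2" by (simp add: norm_vec_def[of A] L2_set_def sum_nonneg)
  finally show ?thesis .
qed

lemma bij_betw_index_pos:
  "bij_betw (index_pos :: 'r::{finite,linorder} \<Rightarrow> nat) UNIV {1..CARD('r)}"
proof -
  have mono: "strict_mono (index_pos :: 'r \<Rightarrow> nat)"
    unfolding strict_mono_def index_pos_def
    by (intro allI impI psubset_card_mono) (auto simp: less_le_not_le)
  then have inj: "inj (index_pos :: 'r \<Rightarrow> nat)" by (rule strict_mono_imp_inj_on)
  have "range (index_pos :: 'r \<Rightarrow> nat) \<subseteq> {1..CARD('r)}"
    by (auto simp: index_pos_def card_gt_0_iff Suc_le_eq card_mono)
  then have "range (index_pos :: 'r \<Rightarrow> nat) = {1..CARD('r)}"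
    using inj by (intro card_subset_eq) (auto simp: card_image)
  with inj show ?thesis by (simp add: bij_betw_def)
qed

subsection \<open>Orthogonal projections, column and row spaces\<close>

lemma column_space_eq_range: "column_space A = range ((*v) A)" for A :: "real^'n^'m"
proof
  have "columns A \<subseteq> range ((*v) A)" by (auto simp: columns_image_basis)
  then show "column_space A \<subseteq> range ((*v) A)"
    unfolding column_space_def
    by (intro span_minimal linear_subspace_image) auto
  show "range ((*v) A) \<subseteq> column_space A"
    by (auto simp: column_space_def matrix_vector_mult_in_columnspace)
qed

lemma norm_orthonormal_columns:
  fixes B :: "real^'r^'m"
  assumes "transpose B ** B = mat 1"
  shows "norm (B *v x) = norm x"
proof -
  have "(norm (B *v x))\<^sup>2 = (norm x)\<^sup>2"
    unfolding power2_norm_eq_inner by (simp add: inner_matrix_transpose matrix_vector_mul_assoc assms)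
  then show ?thesis by simp
qed

text \<open>Splits \<open>w\<close> along the range of \<open>B\<close> and its complement. For
  \<open>w = A *v y\<close> the two parts play the roles of cosine and sine of the angles between
  the ranges of \<open>A\<close> and \<open>B\<close>.\<close>

lemma norm_orthonormal_pythagoras:
  fixes B :: "real^'r^'m"
  assumes "transpose B ** B = mat 1"
  shows "(norm w)\<^sup>2 = (norm (transpose B *v w))\<^sup>2 + (norm ((mat 1 - B ** transpose B) *v w))\<^sup>2"
proof -
  let ?p = "transpose B *v w"
  have "w \<bullet> (B *v ?p) = (norm ?p)\<^sup>2"
    using inner_commute[of w "B *v ?p"] by (simp add: inner_matrix_transpose dot_square_norm)
  moreover have "(mat 1 - B ** transpose B) *v w = w - B *v ?p"
    by (simp add: matrix_vector_mult_diff_rdistrib matrix_vector_mul_assoc)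
  moreover have "(norm (w - B *v ?p))\<^sup>2 = (norm w)\<^sup>2 + (norm (B *v ?p))\<^sup>2 - 2 * (w \<bullet> (B *v ?p))"
    unfolding power2_norm_eq_inner
    by (simp add: inner_diff_left inner_diff_right inner_commute[of "B *v ?p" w])
  ultimately show ?thesis by (simp add: norm_orthonormal_columns[OF assms])
qed

text \<open>B B^T x lies in the range of \<open>B\<close>, and \<open>transpose B\<close>
  annihilates the residual; uniqueness of the projection does the rest.\<close>

lemma orth_proj_orthonormal_basis:
  fixes B :: "real^'r^'m"
  assumes "orthonormal_basis_matrix B T"
  shows "orth_proj T = B ** transpose B"
proof -
  have BB: "transpose B ** B = mat 1" and T: "T = range ((*v) B)"
    using assms by (auto simp: orthonormal_basis_matrix_def column_space_eq_range)
  have sub: "subspace T" unfolding T by (intro linear_subspace_image) auto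
  have "(THE y. y \<in> T \<and> x - y \<in> T\<^sup>\<bottom>) = (B ** transpose B) *v x" for x
  proof (rule the1_equality[OF orth_proj_well_defined[OF sub]])
    have "(B *v z) \<bullet> (x - (B ** transpose B) *v x) = 0" for z
    proof -
      have "transpose B *v (x - (B ** transpose B) *v x) = 0"
        by (simp add: matrix_vector_mult_diff_distrib matrix_vector_mul_assoc matrix_mul_assoc BB)
      then show ?thesis by (simp add: inner_matrix_transpose)
    qed
    then show "(B ** transpose B) *v x \<in> T \<and> x - (B ** transpose B) *v x \<in> T\<^sup>\<bottom>"
      by (auto simp: T orthogonal_comp_def orthogonal_def simp flip: matrix_vector_mul_assoc)
  qed
  then show ?thesis by (simp add: orth_proj_def)
qed

text \<open>Every column of \<open>X\<close> has the form A z, which A A^T fixes because A^T A = 1.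
  It factors \<open>Ystar\<close> for the angle bounds and \<open>Y\<close> for feasibility.\<close>

lemma orthonormal_basis_matrix_reconstruct:
  fixes A :: "real^'r^'m"
  assumes "orthonormal_basis_matrix A (column_space X)"
  shows "A ** (transpose A ** X) = X"
proof -
  have AA: "transpose A ** A = mat 1" and "range ((*v) A) = range ((*v) X)"
    using assms by (auto simp: orthonormal_basis_matrix_def column_space_eq_range)
  then have "\<exists>z. X *v x = A *v z" for x by auto
  then obtain z where z: "\<And>x. X *v x = A *v z x" by metis
  have "(A ** (transpose A ** X)) *v x = X *v x" for x
  proof -
    have "(A ** (transpose A ** X)) *v x = A *v ((transpose A ** A) *v z x)"
      by (simp add: z flip: matrix_vector_mul_assoc)
    then show ?thesis by (simp add: AA z)
  qed
  then show ?thesis by (simp add: matrix_eq)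
qed

section \<open>Lower bounds from the smallest positive singular value\<close>

lemma transpose_bounded_below:
  fixes X :: "real^'n^'m"
  assumes X: "\<And>x. x \<in> S \<Longrightarrow> t * norm x \<le> norm (X *v x)" and z: "z \<in> (*v) X ` S"
  shows "t * norm z \<le> norm (transpose X *v z)"
proof (cases "t \<le> 0 \<or> z = 0")
  case True
  then show ?thesis
    by (auto intro: order_trans[OF mult_nonpos_nonneg])
next
  case False
  obtain x where x: "x \<in> S" "z = X *v x" using z by auto
  \<comment> \<open>Cauchy-Schwarz against a preimage \<open>x\<close> of \<open>z\<close>, whose
    norm is controlled by \<open>t * norm x \<le> norm z\<close>.\<close>
  have "norm z * norm z = (transpose X *v z) \<bullet> x"
    by (simp add: inner_matrix_transpose x(2) flip: dot_square_norm power2_eq_square)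
  also have "\<dots> \<le> norm (transpose X *v z) * norm x" by (rule norm_cauchy_schwarz)
  finally have "t * (norm z * norm z) \<le> norm (transpose X *v z) * (t * norm x)"
    using False by (simp add: mult_left_mono mult.left_commute)
  also have "\<dots> \<le> norm (transpose X *v z) * norm z"
    using X[OF x(1)] x(2) by (intro mult_left_mono) auto
  finally have "(t * norm z) * norm z \<le> norm (transpose X *v z) * norm z" by (simp add: ac_simps)
  then show ?thesis using False by simp
qed

text \<open>Take the orthogonal projection of \<open>x\<close> onto the row space; the remainder is
  orthogonal to every row and is therefore killed by \<open>X\<close>.\<close>

lemma row_space_decomposition:
  fixes X :: "real^'n^'m"
  obtains p where "p \<in> row_space X" "X *v x = X *v p" "norm p \<le> norm x"
proof -
  let ?R = "row_space X"
  have "subspace ?R" by (simp add: row_space_def)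
  then obtain p where p: "p \<in> ?R" "x - p \<in> ?R\<^sup>\<bottom>"
    using orth_proj_well_defined[of ?R x] by blast
  have orth: "y \<bullet> (x - p) = 0" if "y \<in> ?R" for y
    using p(2) that by (auto simp: orthogonal_comp_def orthogonal_def)
  have "X $ i \<bullet> (x - p) = 0" for i
  proof (rule orth)
    have "row i X \<in> rows X" by (auto simp: rows_def)
    then show "X $ i \<in> ?R" by (simp add: row_space_def span_base row_def)
  qed
  then have "X *v (x - p) = 0" by (simp add: vec_eq_iff matrix_vector_mul_component)
  moreover have "norm p * norm p \<le> norm x * norm p"
  proof -
    have "norm p * norm p = p \<bullet> x"
      using orth[OF p(1)] by (simp add: inner_diff_right dot_square_norm power2_eq_square)
    also have "\<dots> \<le> norm x * norm p" by (simp add: inner_commute[of p] norm_cauchy_schwarz)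
    finally show ?thesis .
  qed
  then have "norm p \<le> norm x" by (cases "p = 0") auto
  ultimately show thesis
    using that[OF p(1)] by (simp add: matrix_vector_mult_diff_distrib)
qed

text \<open>\<open>X\<close> is injective on its row space, hence bounded below there by some
  \<open>e > 0\<close>, and that space has dimension \<open>rank X\<close>.\<close>

lemma singular_value_rank_pos:
  fixes X :: "real^'n^'m"
  assumes "rank X > 0"
  shows "singular_value X (rank X) > 0"
proof -
  let ?R = "row_space X"
  have R: "subspace ?R" "dim ?R = rank X" by (simp_all add: row_space_def row_rank_def)
  have "\<forall>x\<in>?R. X *v x = 0 \<longrightarrow> x = 0"
    using nullspace_inter_rowspace[of X] by (auto simp: row_space_def)
  then obtain e where e: "e > 0" "\<forall>x\<in>?R. norm (X *v x) \<ge> e * norm x"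
    using injective_imp_isometric[OF closed_subspace[OF R(1)] R(1), of "(*v) X"] by auto
  have "e \<le> singular_value X (rank X)"
    using assms rank_bound[of X] R e(2) by (intro singular_value_ge[where S = ?R]) auto
  with e show ?thesis by simp
qed

text \<open>The subspace of \<open>singular_value_subspace\<close> need not be the row space, but the projection
  onto the row space maps it onto the row space and does not increase norms.\<close>

lemma singular_value_row_space:
  fixes X :: "real^'n^'m"
  assumes r: "rank X > 0" and x: "x \<in> row_space X"
  shows "singular_value X (rank X) * norm x \<le> norm (X *v x)"
proof -
  let ?R = "row_space X" and ?s = "singular_value X (rank X)"
  obtain S where S: "subspace S" "rank X \<le> dim S"
    and ge: "\<And>x. x \<in> S \<Longrightarrow> ?s * norm x \<le> norm (X *v x)"
    using r rank_bound[of X] by (auto intro: singular_value_subspace[of "rank X" X])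
  have s: "?s > 0" by (rule singular_value_rank_pos[OF r])
  have "X *v y = 0 \<Longrightarrow> y = 0" if "y \<in> S" for y
    using ge[OF that] s by (auto simp: mult_le_0_iff)
  then have "inj_on ((*v) X) S"
    using S(1) by (auto simp: inj_on_def subspace_diff matrix_vector_mult_diff_distrib)
      (metis eq_iff_diff_eq_0 matrix_vector_mult_diff_distrib subspace_diff)
  \<comment> \<open>Since \<open>dim S\<close> is at least the rank, the image of \<open>S\<close>
    fills the whole range of \<open>X\<close>; so \<open>X *v x\<close> has a preimage
    \<open>y\<close> in \<open>S\<close>.\<close>
  then have "dim ((*v) X ` S) = dim S"
    using S(1) by (intro dim_image_eq) (auto simp: span_eq_iff[THEN iffD2])
  then have "(*v) X ` S = range ((*v) X)"
    using S by (intro subspace_dim_equal linear_subspace_image) (auto simp: rank_dim_range)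
  then obtain y where y: "y \<in> S" "X *v x = X *v y" by blast
  obtain p where p: "p \<in> ?R" "X *v y = X *v p" "norm p \<le> norm y" by (rule row_space_decomposition)
  have "x = p"
    using matrix_vector_mul_injective_on_rowspace[of X x p] x p y by (simp add: row_space_def)
  then have "?s * norm x \<le> ?s * norm y" using p(3) s by simp
  with ge[OF y(1)] y(2) show ?thesis by simp
qed

lemma singular_value_column_space:
  fixes X :: "real^'n^'m"
  assumes r: "rank X > 0" and z: "z \<in> column_space X"
  shows "singular_value X (rank X) * norm z \<le> norm (transpose X *v z)"
proof (rule transpose_bounded_below)
  show "singular_value X (rank X) * norm x \<le> norm (X *v x)" if "x \<in> row_space X" for x
    using singular_value_row_space[OF r that] .
  show "z \<in> (*v) X ` row_space X"
    using z row_space_decomposition[of X] unfolding column_space_eq_range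
    by (metis (no_types, lifting) imageE image_eqI)
qed

text \<open>After transposing, \<open>transpose C\<close> acts on each column of
  \<open>transpose P\<close> separately and stretches it by at least \<open>t\<close>.\<close>

lemma bounded_below_frobenius:
  fixes P :: "real^'r^'m" and C :: "real^'n^'r"
  assumes C: "\<And>y. t * norm y \<le> norm (transpose C *v y)" and "t \<ge> 0"
  shows "t * norm P \<le> norm (P ** C)"
proof -
  have "(t * norm P)\<^sup>2 = t\<^sup>2 * (norm (transpose P))\<^sup>2"
    by (simp add: power_mult_distrib frobenius_norm_transpose)
  also have "\<dots> = (\<Sum>j\<in>UNIV. (t * norm (transpose P *v axis j 1))\<^sup>2)"
    by (simp add: frobenius_norm_columns sum_distrib_left power_mult_distrib)
  also have "\<dots> \<le> (\<Sum>j\<in>UNIV. (norm ((transpose C ** transpose P) *v axis j 1))\<^sup>2)"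
    using C \<open>t \<ge> 0\<close> by (intro sum_mono power_mono) (auto simp flip: matrix_vector_mul_assoc)
  also have "\<dots> = (norm (P ** C))\<^sup>2"
    using frobenius_norm_columns[of "transpose (P ** C)"] frobenius_norm_transpose[of "P ** C"]
    by (simp add: matrix_transpose_mul)
  finally show ?thesis by (rule power2_le_imp_le) simp
qed

lemma bounded_below_spectral:
  fixes P :: "real^'r^'m" and C :: "real^'n^'r"
  assumes C: "\<And>y. t * norm y \<le> norm (transpose C *v y)" and "t > 0"
  shows "t * spectral_norm P \<le> spectral_norm (P ** C)"
proof -
  have "spectral_norm (transpose P) \<le> spectral_norm (transpose (P ** C)) / t"
  proof (rule spectral_norm_leI)
    fix w
    have "t * norm (transpose P *v w) \<le> norm (transpose (P ** C) *v w)"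
      using C by (simp add: matrix_transpose_mul flip: matrix_vector_mul_assoc)
    also have "\<dots> \<le> spectral_norm (transpose (P ** C)) * norm w" by (rule norm_matrix_vector_le)
    finally show "norm (transpose P *v w) \<le> spectral_norm (transpose (P ** C)) / t * norm w"
      using \<open>t > 0\<close> by (simp add: field_simps)
  qed (use \<open>t > 0\<close> in \<open>intro divide_nonneg_pos spectral_norm_nonneg\<close>)
  then show ?thesis using \<open>t > 0\<close> by (simp add: spectral_norm_transpose field_simps)
qed

lemma spectral_norm_diagonal_le:
  fixes s :: "'n::finite \<Rightarrow> real"
  assumes "\<And>i. \<bar>s i\<bar> \<le> b"
  shows "spectral_norm (\<chi> i j. if i = j then s i else 0 :: real^'n::finite^'n::finite) \<le> b"
proof (rule spectral_norm_leI)
  show b: "0 \<le> b" using assms abs_ge_zero order_trans by blast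
  fix x :: "real^'n"
  have "(\<chi> i j. if i = j then s i else 0) *v x = (\<chi> i. s i * x $ i)"
    by (simp add: vec_eq_iff matrix_vector_mult_def if_distrib if_distribR sum.delta cong: if_cong)
  also have "norm \<dots> = L2_set (\<lambda>i. \<bar>s i\<bar> * \<bar>x $ i\<bar>) UNIV"
    by (simp add: norm_vec_def abs_mult)
  also have "\<dots> \<le> L2_set (\<lambda>i. b * \<bar>x $ i\<bar>) UNIV"
    using assms by (intro L2_set_mono mult_right_mono) auto
  also have "\<dots> = b * norm x" using b by (simp add: L2_set_right_distrib norm_vec_def)
  finally show "norm ((\<chi> i j. if i = j then s i else 0) *v x) \<le> b * norm x" .
qed

lemma sum_index_pos:
  "(\<Sum>i\<in>UNIV. f (index_pos (i :: 'r::{finite,linorder}))) = (\<Sum>k=1..CARD('r). f k)"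
  using bij_betw_index_pos by (rule sum.reindex_bij_betw)

lemma index_pos_bounds: "1 \<le> index_pos i" "index_pos i \<le> CARD('r)" for i :: "'r::{finite,linorder}"
  using bij_betw_apply[OF bij_betw_index_pos, of i] by auto

subsection \<open>Canonical angles\<close>

text \<open>\<open>B\<close> is an isometry and \<open>transpose A\<close> a contraction. The bound
  keeps the argument of \<open>arccos\<close> in its proper domain.\<close>

lemma singular_value_cosine_le_1:
  fixes A B :: "real^'r^'m"
  assumes AA: "transpose A ** A = mat 1" and BB: "transpose B ** B = mat 1"
    and k: "1 \<le> k" "k \<le> CARD('r)"
  shows "singular_value (transpose A ** B) k \<le> 1"
proof -
  let ?G = "transpose A ** B"
  obtain S where S: "subspace S" "k \<le> dim S" "\<And>x. x \<in> S \<Longrightarrow> singular_value ?G k * norm x \<le> norm (?G *v x)"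
    by (rule singular_value_subspace[OF k, of ?G]) (rule that)
  have "dim S \<noteq> 0" using S(2) k by linarith
  then obtain x where x: "x \<in> S" "x \<noteq> 0" by auto
  have "(norm (?G *v x))\<^sup>2 \<le> (norm x)\<^sup>2"
    using norm_orthonormal_pythagoras[OF AA, of "B *v x"]
    by (simp add: norm_orthonormal_columns[OF BB] flip: matrix_vector_mul_assoc)
  then have "norm (?G *v x) \<le> norm x" by (rule power2_le_imp_le) simp
  with S(3)[OF x(1)] have "singular_value ?G k * norm x \<le> 1 * norm x" by linarith
  then show ?thesis using x(2) by (simp only: mult_le_cancel_right) simp
qed

text \<open>Pythagoras on each column of \<open>A\<close> gives 1 minus the squared norm of that
  column of B^T A. Summing gives r minus the sum of the squared cosines.\<close>

lemma frobenius_norm_sines: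
  fixes A B :: "real^'r^'m"
  assumes AA: "transpose A ** A = mat 1" and BB: "transpose B ** B = mat 1"
  shows "(norm ((mat 1 - B ** transpose B) ** A))\<^sup>2
    = (\<Sum>k=1..CARD('r). 1 - (singular_value (transpose A ** B) k)\<^sup>2)"
proof -
  have "(norm ((mat 1 - B ** transpose B) ** A))\<^sup>2
      = (\<Sum>j\<in>UNIV. (norm (A *v axis j 1))\<^sup>2 - (norm ((transpose B ** A) *v axis j 1))\<^sup>2)"
    unfolding frobenius_norm_columns
  proof (rule sum.cong)
    fix j :: 'r
    show "(norm (((mat 1 - B ** transpose B) ** A) *v axis j 1))\<^sup>2
      = (norm (A *v axis j 1))\<^sup>2 - (norm ((transpose B ** A) *v axis j 1))\<^sup>2"
      using norm_orthonormal_pythagoras[OF BB, of "A *v axis j 1"]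
      by (simp flip: matrix_vector_mul_assoc)
  qed simp
  also have "\<dots> = CARD('r) - (norm (transpose B ** A))\<^sup>2"
    by (simp add: sum_subtractf norm_orthonormal_columns[OF AA] norm_axis_1 flip: frobenius_norm_columns)
  also have "norm (transpose B ** A) = norm (transpose A ** B)"
    using frobenius_norm_transpose[of "transpose A ** B"] by (simp add: matrix_transpose_mul)
  also have "CARD('r) - (norm (transpose A ** B))\<^sup>2 = (\<Sum>k=1..CARD('r). 1 - (singular_value (transpose A ** B) k)\<^sup>2)"
    by (simp only: sum_subtractf sum_singular_values_squared) simp
  finally show ?thesis .
qed

text \<open>If \<open>q\<close> is the norm on the right, Pythagoras shows that B^T A shrinks
  vectors by at most the factor sqrt (1 - q^2). Passing to the transpose bounds every cosine from
  below by this factor; for q at least 1 the claim is immediate.\<close>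

lemma spectral_norm_sines:
  fixes A B :: "real^'r^'m"
  assumes AA: "transpose A ** A = mat 1" and BB: "transpose B ** B = mat 1"
    and k: "1 \<le> k" "k \<le> CARD('r)"
  shows "sqrt (1 - (singular_value (transpose A ** B) k)\<^sup>2) \<le> spectral_norm ((mat 1 - B ** transpose B) ** A)"
proof -
  let ?G = "transpose A ** B" and ?Q = "(mat 1 - B ** transpose B) ** A"
  define q where "q = spectral_norm ?Q"
  have q: "q \<ge> 0" by (simp add: q_def spectral_norm_nonneg)
  have "1 - q\<^sup>2 \<le> (singular_value ?G k)\<^sup>2"
  proof (cases "q < 1")
    case False
    then have "1 \<le> q\<^sup>2" by simp
    then show ?thesis by (smt (verit) zero_le_power2)
  next
    case True
    then have q1: "q\<^sup>2 < 1" using q by (simp add: abs_square_less_1)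
    define t where "t = sqrt (1 - q\<^sup>2)"
    have t: "t > 0" "t\<^sup>2 = 1 - q\<^sup>2" using q1 by (auto simp: t_def)
    have G': "t * norm y \<le> norm (transpose ?G *v y)" for y
    proof -
      have "(norm (?Q *v y))\<^sup>2 \<le> (q * norm y)\<^sup>2"
        unfolding q_def by (intro power_mono norm_matrix_vector_le) simp
      then have "(t * norm y)\<^sup>2 \<le> (norm (transpose ?G *v y))\<^sup>2"
        using norm_orthonormal_pythagoras[OF BB, of "A *v y"]
        by (simp add: norm_orthonormal_columns[OF AA] matrix_transpose_mul matrix_vector_mul_assoc
            power_mult_distrib t(2) left_diff_distrib)
      then show ?thesis by (rule power2_le_imp_le) simp
    qed
    have "x = 0" if "transpose ?G *v x = 0" for x
      using G'[of x] that t(1) by (simp add: mult_le_0_iff)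
    then have "inj ((*v) (transpose ?G))"
      by (simp add: linear_injective_0)
    \<comment> \<open>\<open>?G\<close> is square, so injectivity gives surjectivity, and
      \<open>transpose_bounded_below\<close> then covers every vector.\<close>
    then have surj: "range ((*v) (transpose ?G)) = UNIV"
      using linear_injective_imp_surjective[of "(*v) (transpose ?G)"] by auto
    have "t * norm z \<le> norm (?G *v z)" for z
      using transpose_bounded_below[of UNIV t "transpose ?G" z] G' surj by auto
    then have "t \<le> singular_value ?G k"
      using k by (intro singular_value_ge[where S = UNIV]) auto
    then show ?thesis using t by (metis less_imp_le power_mono)
  qed
  then show ?thesis
    using q unfolding q_def[symmetric] by (intro real_le_lsqrt) auto
qed

text \<open>Stated for a general \<open>X\<close> and lower bound \<open>t\<close> so that it serves
  both angle estimates: \<open>X = Ystar\<close> for the column spaces and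
  \<open>X = transpose Ystar\<close> for the row spaces.\<close>

lemma sin_theta:
  fixes X :: "real^'n^'m" and \<Theta> :: "real^('r::{finite,linorder})^('r::{finite,linorder})"
  assumes angle: "is_canonical_angle_matrix (column_space X) T \<Theta>"
    and t: "t > 0" "\<forall>z\<in>column_space X. t * norm z \<le> norm (transpose X *v z)"
  shows "t * norm (sin_diag \<Theta>) \<le> norm (orth_proj_compl T ** X)"
    and "t * spectral_norm (sin_diag \<Theta>) \<le> spectral_norm (orth_proj_compl T ** X)"
proof -
  obtain A B :: "real^('r::{finite,linorder})^'m" where A: "orthonormal_basis_matrix A (column_space X)"
    and B: "orthonormal_basis_matrix B T"
    and \<Theta>: "\<Theta> = (\<chi> i j. if i = j then arccos (singular_value (transpose A ** B) (index_pos i)) else 0)"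
    using angle unfolding is_canonical_angle_matrix_def by blast
  have AA: "transpose A ** A = mat 1" and BB: "transpose B ** B = mat 1"
    using A B by (auto simp: orthonormal_basis_matrix_def)
  let ?\<sigma> = "\<lambda>i::'r. singular_value (transpose A ** B) (index_pos i)"
  let ?Q = "(mat 1 - B ** transpose B) ** A"
  let ?C = "transpose A ** X"
  have proj: "orth_proj_compl T ** X = ?Q ** ?C"
    using orthonormal_basis_matrix_reconstruct[OF A] orth_proj_orthonormal_basis[OF B]
    by (simp add: orth_proj_compl_def flip: matrix_mul_assoc)
  \<comment> \<open>The transpose of \<open>?C\<close> maps \<open>y\<close> to X^T (A y), and A y
    lies in the column space of \<open>X\<close> with the same norm as \<open>y\<close>.\<close>
  have C: "t * norm y \<le> norm (transpose ?C *v y)" for y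
  proof -
    have "A *v y \<in> column_space X"
      using A by (auto simp: orthonormal_basis_matrix_def column_space_eq_range[of A])
    from bspec[OF t(2) this] show ?thesis
      by (simp add: norm_orthonormal_columns[OF AA] matrix_transpose_mul matrix_vector_mul_assoc)
  qed
  have \<sigma>: "0 \<le> ?\<sigma> i" "?\<sigma> i \<le> 1" for i
    using singular_value_nonneg[OF index_pos_bounds, of "transpose A ** B" i]
      singular_value_cosine_le_1[OF AA BB index_pos_bounds, of i] by simp_all
  have sq: "(?\<sigma> i)\<^sup>2 \<le> 1" for i using \<sigma>[of i] by (simp add: power_le_one)
  have sin: "sin_diag \<Theta> = (\<chi> i j. if i = j then sqrt (1 - (?\<sigma> i)\<^sup>2) else 0)"
    using \<sigma> by (simp add: sin_diag_def \<Theta> vec_eq_iff sin_arccos order_trans[of "-1" 0])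
  have "(norm (sin_diag \<Theta>))\<^sup>2 = (\<Sum>i\<in>UNIV. 1 - (?\<sigma> i)\<^sup>2)"
    unfolding frobenius_norm_eq sin
    by (simp add: sum_nonneg if_distrib[of "\<lambda>x. x\<^sup>2"] sum.delta sq cong: if_cong)
  also have "\<dots> = (norm ?Q)\<^sup>2"
    by (simp add: frobenius_norm_sines[OF AA BB] sum_index_pos[of "\<lambda>k. 1 - (singular_value (transpose A ** B) k)\<^sup>2"])
  finally have "norm (sin_diag \<Theta>) = norm ?Q" by simp
  then show "t * norm (sin_diag \<Theta>) \<le> norm (orth_proj_compl T ** X)"
    using bounded_below_frobenius[OF C] t(1) by (simp add: proj)
  have "spectral_norm (sin_diag \<Theta>) \<le> spectral_norm ?Q"
    unfolding sin using sq
    by (intro spectral_norm_diagonal_le) (simp add: spectral_norm_sines[OF AA BB index_pos_bounds])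
  then have "t * spectral_norm (sin_diag \<Theta>) \<le> t * spectral_norm ?Q" using t(1) by simp
  also have "\<dots> \<le> spectral_norm (?Q ** ?C)" by (rule bounded_below_spectral[OF C t(1)])
  finally show "t * spectral_norm (sin_diag \<Theta>) \<le> spectral_norm (orth_proj_compl T ** X)"
    by (simp add: proj)
qed

subsection \<open>The perturbation bound\<close>

lemma sampling_minus: "sampling \<Omega> (- X) = - sampling \<Omega> X" for X :: "real^'n^'m"
  by (simp add: sampling_def vec_eq_iff)

text \<open>Dropping one side of the absolute value in \<open>tau\<close> bounds the scaled full
  norm by the scaled sampled norm plus \<open>tau\<close>; multiplying by sqrt (m n) clears the
  scaling.\<close>

lemma frobenius_norm_le_tau:
  fixes Yhat Ystar :: "real^'n^'m" and \<Omega> :: "('m \<times> 'n) set"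
  assumes "\<Omega> \<noteq> {}"
  shows "norm (Yhat - Ystar)
    \<le> sqrt (real CARD('m) * real CARD('n) / card \<Omega>) * norm (sampling \<Omega> (Yhat - Ystar))
      + sqrt (real CARD('m) * real CARD('n)) * \<bar>tau \<Omega> Yhat Ystar\<bar>"
proof -
  let ?s = "sqrt (real CARD('m) * real CARD('n))" and ?w = "sqrt (card \<Omega>)"
  let ?a = "norm (sampling \<Omega> (Yhat - Ystar))" and ?b = "norm (Yhat - Ystar)"
  have s: "?s > 0" by simp
  have "1 / ?s * ?b \<le> 1 / ?w * ?a + tau \<Omega> Yhat Ystar"
    unfolding tau_def by linarith
  then have "?s * (1 / ?s * ?b) \<le> ?s * (1 / ?w * ?a + \<bar>tau \<Omega> Yhat Ystar\<bar>)"
    using s by (intro mult_left_mono) auto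
  moreover have "?s * (1 / ?s * ?b) = ?b" using s by (simp del: real_sqrt_gt_0_iff)
  moreover have "sqrt (real CARD('m) * real CARD('n) / card \<Omega>) = ?s / ?w"
    by (rule real_sqrt_divide)
  ultimately show ?thesis by (simp add: distrib_left)
qed

lemma orth_proj_compl_mult: "orth_proj_compl S ** D = D - orth_proj S ** D"
  by (simp add: orth_proj_compl_def matrix_diff_rdistrib)

lemma orth_proj_compl_column_space:
  fixes B :: "real^'r^'m"
  assumes "orthonormal_basis_matrix B (column_space X)"
  shows "orth_proj_compl (column_space X) ** X = 0"
  using orthonormal_basis_matrix_reconstruct[OF assms]
  by (simp add: orth_proj_compl_mult orth_proj_orthonormal_basis[OF assms] flip: matrix_mul_assoc)

lemma transpose_diff: "transpose (A - B) = transpose A - transpose B"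
  by (simp add: transpose_def vec_eq_iff)

lemma row_space_eq_column_space: "row_space A = column_space (transpose A)" for A :: "real^'n^'m"
  by (simp add: row_space_def column_space_def)

lemma frobenius_norm_diff_le:
  fixes Y E Yhat Ystar :: "real^'n^'m" and Ustar :: "real^'r^'m" and Vstar :: "real^'r^'n"
    and \<Omega> :: "('m \<times> 'n) set" and B :: "real^'r^'m"
  assumes Y: "\<forall>i j. Y $ i $ j \<in> {-k..k}" and B: "orthonormal_basis_matrix B (column_space Y)"
    and Yhat: "Yhat = Y + E" and Omega: "\<Omega> \<noteq> {}"
    and opt: "global_optimum k \<Omega> Yhat Ustar Vstar" and Ystar: "Ystar = Ustar ** transpose Vstar"
  shows "norm (Ystar - Y) \<le> sqrt (real CARD('m) * real CARD('n) / card \<Omega>) * norm (sampling \<Omega> E)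
    + norm E + sqrt (real CARD('m) * real CARD('n)) * \<bar>tau \<Omega> Yhat Ystar\<bar>"
proof -
  \<comment> \<open>The optimisation ranges over factor pairs with \<open>'r\<close> columns, so
    \<open>Y\<close> must be exhibited as such a product before it can compete with
    \<open>Ystar\<close>.\<close>
  let ?V = "transpose Y ** B"
  have fact: "B ** transpose ?V = Y"
    using orthonormal_basis_matrix_reconstruct[OF B] by (simp add: matrix_transpose_mul)
  then have "feasible k B ?V"
    using Y by (auto simp: feasible_def abs_le_iff minus_le_iff)
  then have "objective \<Omega> Yhat Ustar Vstar \<le> objective \<Omega> Yhat B ?V"
    using opt by (simp add: global_optimum_def)
  then have "(norm (sampling \<Omega> (Ystar - Yhat)))\<^sup>2 \<le> (norm (sampling \<Omega> (Y - Yhat)))\<^sup>2"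
    by (simp add: objective_def fact Ystar)
  then have "norm (sampling \<Omega> (Ystar - Yhat)) \<le> norm (sampling \<Omega> (Y - Yhat))"
    by (rule power2_le_imp_le) simp
  moreover have "norm (sampling \<Omega> (Ystar - Yhat)) = norm (sampling \<Omega> (Yhat - Ystar))"
    using sampling_minus[of \<Omega> "Yhat - Ystar"] by simp
  moreover have "norm (sampling \<Omega> (Y - Yhat)) = norm (sampling \<Omega> E)"
    using sampling_minus[of \<Omega> E] by (simp add: Yhat)
  ultimately have "norm (sampling \<Omega> (Yhat - Ystar)) \<le> norm (sampling \<Omega> E)" by simp
  then have "sqrt (real CARD('m) * real CARD('n) / card \<Omega>) * norm (sampling \<Omega> (Yhat - Ystar))
      \<le> sqrt (real CARD('m) * real CARD('n) / card \<Omega>) * norm (sampling \<Omega> E)"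
    by (rule mult_left_mono) simp
  moreover have "norm (Ystar - Y) \<le> norm (Yhat - Ystar) + norm E"
    using norm_triangle_ineq4[of E "Yhat - Ystar"] by (simp add: Yhat algebra_simps)
  ultimately show ?thesis
    using frobenius_norm_le_tau[OF Omega, of Yhat Ystar] by linarith
qed

theorem theorem3:
  fixes Y E Yhat Ystar :: "real^'n^'m"
    and Ustar :: "real^('r::{finite,linorder})^'m" and Vstar :: "real^('r::{finite,linorder})^'n"
    and \<Omega> :: "('m \<times> 'n) set"
    and k \<delta> :: real
    and N Nstar :: "(real^'m) set" and M Mstar :: "(real^'n) set"
    and \<Theta> \<Phi> :: "real^('r::{finite,linorder})^('r::{finite,linorder})"
  assumes dims: "CARD('r) \<le> CARD('m)" "CARD('m) \<le> CARD('n)"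
    and k: "k > 0"
    and Y: "rank Y = CARD('r)" "\<forall>i j. Y $ i $ j \<in> {-k..k}"
    and Yhat: "Yhat = Y + E"
    and Omega: "\<Omega> \<noteq> {}"
    and opt: "global_optimum k \<Omega> Yhat Ustar Vstar"
    and Ystar: "Ystar = Ustar ** transpose Vstar" "rank Ystar = CARD('r)"
    and N: "N = column_space Y" and M: "M = row_space Y"
    and Nstar: "Nstar = column_space Ystar" and Mstar: "Mstar = row_space Ystar"
    and Theta: "is_canonical_angle_matrix Nstar N \<Theta>"
    and Phi: "is_canonical_angle_matrix Mstar M \<Phi>"
    and delta: "\<delta> = singular_value Ystar CARD('r)"
  shows "\<exists>\<Delta> :: real^'n^'m.
    (let r = CARD('r);
         bound = sqrt (real CARD('m) * real CARD('n) / card \<Omega>) * frobenius_norm (sampling \<Omega> E)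
           + frobenius_norm E
           + sqrt (real CARD('m) * real CARD('n)) * \<bar>tau \<Omega> Yhat Ystar\<bar>;
         PNc\<Delta> = orth_proj_compl N ** \<Delta>;
         PMc\<Delta>T = orth_proj_compl M ** transpose \<Delta>;
         Y\<^sub>N = Y + orth_proj N ** \<Delta>;
         Y\<^sub>M = Y + transpose (orth_proj M ** transpose \<Delta>)
     in
       frobenius_norm \<Delta> \<le> bound \<and>
       spectral_norm \<Delta> \<le> bound \<and>
       frobenius_norm (sin_diag \<Theta>) \<le> sqrt 2 / \<delta> * frobenius_norm PNc\<Delta> \<and>
       spectral_norm (sin_diag \<Theta>) \<le> sqrt 2 / \<delta> * spectral_norm PNc\<Delta> \<and>
       frobenius_norm (sin_diag \<Phi>) \<le> sqrt 2 / \<delta> * frobenius_norm PMc\<Delta>T \<and>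
       spectral_norm (sin_diag \<Phi>) \<le> sqrt 2 / \<delta> * spectral_norm PMc\<Delta>T \<and>
       singular_value Y r - spectral_norm \<Delta> \<le> \<delta> \<and>
       \<delta> \<le> singular_value Y r + spectral_norm \<Delta> \<and>
       singular_value Y\<^sub>N r - spectral_norm PNc\<Delta> \<le> \<delta> \<and>
       \<delta> \<le> singular_value Y\<^sub>N r + spectral_norm PNc\<Delta> \<and>
       singular_value Y\<^sub>M r - spectral_norm PMc\<Delta>T \<le> \<delta> \<and>
       \<delta> \<le> singular_value Y\<^sub>M r + spectral_norm PMc\<Delta>T)"
proof -
  let ?r = "CARD('r)"
  define \<Delta> where "\<Delta> = Ystar - Y"
  have r: "?r = rank Ystar" "rank Ystar > 0" using Ystar(2) by simp_all
  \<comment> \<open>The list of singular values has one entry per column, so the index is valid as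
    soon as r is at most n.\<close>
  have k: "1 \<le> ?r" "?r \<le> CARD('n)" using dims by (simp_all add: Suc_leI)
  \<comment> \<open>The angle hypotheses already carry orthonormal bases of the column spaces of
    \<open>Y\<close> and of its transpose.\<close>
  obtain B :: "real^('r::{finite,linorder})^'m" where B: "orthonormal_basis_matrix B (column_space Y)"
    using Theta unfolding is_canonical_angle_matrix_def N by blast
  obtain D :: "real^('r::{finite,linorder})^'n" where D: "orthonormal_basis_matrix D (column_space (transpose Y))"
    using Phi unfolding is_canonical_angle_matrix_def M row_space_eq_column_space by blast
  have delta_pos: "\<delta> > 0" unfolding delta r(1) by (rule singular_value_rank_pos[OF r(2)])
  have PN: "orth_proj_compl N ** \<Delta> = orth_proj_compl N ** Ystar"
    by (simp add: \<Delta>_def N matrix_diff_ldistrib orth_proj_compl_column_space[OF B])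
  have PM: "orth_proj_compl M ** transpose \<Delta> = orth_proj_compl M ** transpose Ystar"
    by (simp add: \<Delta>_def M row_space_eq_column_space matrix_diff_ldistrib transpose_diff
        orth_proj_compl_column_space[OF D])
  \<comment> \<open>Weakens the constant 1 from \<open>sin_theta\<close> to
    \<open>sqrt 2\<close>.\<close>
  have sqrt2: "x \<le> sqrt 2 / \<delta> * y" if "\<delta> * x \<le> y" "0 \<le> y" for x y
  proof -
    have "\<delta> * x \<le> sqrt 2 * y" using that mult_right_mono[of 1 "sqrt 2" y] by simp
    then show ?thesis using delta_pos by (simp add: field_simps)
  qed
  have "\<forall>z\<in>column_space Ystar. \<delta> * norm z \<le> norm (transpose Ystar *v z)"
    using singular_value_column_space[OF r(2), folded r(1), folded delta] by blast
  note sin_\<Theta> = sin_theta[OF Theta[unfolded Nstar] delta_pos this, folded PN]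
  have "\<forall>x\<in>column_space (transpose Ystar). \<delta> * norm x \<le> norm (transpose (transpose Ystar) *v x)"
    using singular_value_row_space[OF r(2), folded r(1), folded delta] by (simp add: row_space_eq_column_space)
  note sin_\<Phi> = sin_theta[OF Phi[unfolded Mstar row_space_eq_column_space] delta_pos this, folded PM]
  note sin_bounds = sqrt2[OF sin_\<Theta>(1) norm_ge_zero] sqrt2[OF sin_\<Theta>(2) spectral_norm_nonneg]
    sqrt2[OF sin_\<Phi>(1) norm_ge_zero] sqrt2[OF sin_\<Phi>(2) spectral_norm_nonneg]
  have bound: "norm \<Delta> \<le> sqrt (real CARD('m) * real CARD('n) / card \<Omega>) * norm (sampling \<Omega> E)
    + norm E + sqrt (real CARD('m) * real CARD('n)) * \<bar>tau \<Omega> Yhat Ystar\<bar>"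
    unfolding \<Delta>_def by (rule frobenius_norm_diff_le[OF Y(2) B Yhat Omega opt Ystar(1)])
  note weyl = singular_value_weyl[OF k, of Ystar, folded delta]
  have wY: "\<bar>\<delta> - singular_value Y ?r\<bar> \<le> spectral_norm \<Delta>"
    unfolding \<Delta>_def by (rule weyl)
  \<comment> \<open>Adding the projected part of the perturbation to \<open>Y\<close> leaves only
    the complementary part for Weyl's inequality.\<close>
  have "Ystar - (Y + orth_proj N ** \<Delta>) = orth_proj_compl N ** \<Delta>"
    by (simp add: orth_proj_compl_mult \<Delta>_def)
  with weyl have wN: "\<bar>\<delta> - singular_value (Y + orth_proj N ** \<Delta>) ?r\<bar> \<le> spectral_norm (orth_proj_compl N ** \<Delta>)"
    by metis
  \<comment> \<open>The same for row spaces, where the difference appears transposed; the spectral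
    norm is invariant under transposition.\<close>
  have "Ystar - (Y + transpose (orth_proj M ** transpose \<Delta>)) = transpose (orth_proj_compl M ** transpose \<Delta>)"
    by (simp add: orth_proj_compl_mult transpose_diff) (simp add: \<Delta>_def)
  with weyl have wM: "\<bar>\<delta> - singular_value (Y + transpose (orth_proj M ** transpose \<Delta>)) ?r\<bar>
      \<le> spectral_norm (orth_proj_compl M ** transpose \<Delta>)"
    by (metis spectral_norm_transpose)
  show ?thesis
    unfolding Let_def
  proof (intro exI[of _ \<Delta>] conjI)
    show "spectral_norm \<Delta> \<le> sqrt (real CARD('m) * real CARD('n) / card \<Omega>) * norm (sampling \<Omega> E)
      + norm E + sqrt (real CARD('m) * real CARD('n)) * \<bar>tau \<Omega> Yhat Ystar\<bar>"
      using spectral_norm_le_frobenius bound by (rule order_trans)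
  qed (fact bound sin_bounds | insert wY wN wM, linarith)+
qed

end
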